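(* There is a constant $C>0$ such that for every string $S$ of length $n\ge 1$, the number of runs (maximal blocks of consecutive equal entries) in the array $\mathsf{OC}_S[1..n]$ is at most $C\sqrt{n}$; i.e., the number of runs in the $\mathsf{OC}$ array of $S$ is $\mathcal O(\sqrt n)$.
   Context: For a string $S=S[1]\cdots S[n]$, $S[1..i]$ denotes its prefix of length $i$. A border of a string $w$ is a string $\beta\neq w$ (possibly empty) that is both a prefix and a suffix of $w$. A string $w$ is closed if $|w|=1$ or $w$ has a nonempty border $\beta$ that occurs in $w$ only as a prefix and as a suffix. The OC array of $S$ is the binary array $\mathsf{OC}_S[1..n]$ with $\mathsf{OC}_S[i]=1$ if $S[1..i]$ is closed and $\mathsf{OC}_S[i]=0$ otherwise. A run of the array is a maximal block of consecutive positions carrying the same value. *)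

theory Defs
  imports Complex_Main "HOL-Library.Sublist"
begin

definition border :: "'a list \<Rightarrow> 'a list \<Rightarrow> bool" where
  "border b w \<longleftrightarrow> b \<noteq> w \<and> prefix b w \<and> suffix b w"

text \<open>In a factorization \<open>w = u @ b @ v\<close> the occurrence of \<open>b\<close> is the prefix one iff \<open>u = []\<close>
  and the suffix one iff \<open>v = []\<close>; the two occurrences may overlap.\<close>

definition closed_string :: "'a list \<Rightarrow> bool" where
  "closed_string w \<longleftrightarrow> length w = 1 \<or>
     (\<exists>b. b \<noteq> [] \<and> border b w \<and> (\<forall>u v. w = u @ b @ v \<longrightarrow> u = [] \<or> v = []))"

text \<open>Arrays are indexed from 1; only the entries at positions \<open>1, \<dots>, length S\<close> are meaningful.\<close>

definition OC :: "'a list \<Rightarrow> nat \<Rightarrow> nat" where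
  "OC S i = (if closed_string (take i S) then 1 else 0)"

definition constant_block :: "(nat \<Rightarrow> 'b) \<Rightarrow> nat \<Rightarrow> nat set \<Rightarrow> bool" where
  "constant_block A n B \<longleftrightarrow>
     (\<exists>i j. 1 \<le> i \<and> i \<le> j \<and> j \<le> n \<and> B = {i..j}) \<and> (\<forall>k\<in>B. \<forall>l\<in>B. A k = A l)"

definition runs :: "(nat \<Rightarrow> 'b) \<Rightarrow> nat \<Rightarrow> nat set set" where
  "runs A n = {B. constant_block A n B \<and> (\<forall>B'. constant_block A n B' \<and> B \<subseteq> B' \<longrightarrow> B' = B)}"

lemma finite_runs: "finite (runs A n)"
proof -
  have "runs A n \<subseteq> Pow {1..n}"
    unfolding runs_def constant_block_def by auto
  then show ?thesis
    by (rule finite_subset) simp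
qed

text \<open>Injective renaming of letters does not change the OC array. Hence the OC arrays of strings
  over an arbitrary alphabet are exactly those of strings over the alphabet \<open>nat\<close>, so a bound for
  \<open>nat list\<close> holds, with the same constant, for every alphabet.\<close>

lemma closed_string_map_imp:
  assumes "inj_on f (set w)" and "closed_string w"
  shows "closed_string (map f w)"
proof (cases "length w = 1")
  case True
  then show ?thesis by (simp add: closed_string_def)
next
  case False
  with assms(2) obtain b where b: "b \<noteq> []" "border b w"
      "\<And>u v. w = u @ b @ v \<Longrightarrow> u = [] \<or> v = []"
    by (auto simp: closed_string_def)
  have sub: "set b \<subseteq> set w"
    using b(2) by (auto simp: border_def dest: set_mono_prefix)
  have inj: "xs = ys" if "map f xs = map f ys" "set xs \<subseteq> set w" "set ys \<subseteq> set w" for xs ys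
    using that assms(1) by (metis Un_least inj_on_map_eq_map inj_on_subset)
  have 1: "border (map f b) (map f w)"
    using b(2) inj[of b w] sub
    by (auto simp: border_def map_mono_prefix map_mono_suffix)
  have 2: "u = [] \<or> v = []" if eq: "map f w = u @ map f b @ v" for u v
  proof -
    from eq obtain u' b' v' where w: "w = u' @ b' @ v'"
        and m: "map f u' = u" "map f b' = map f b" "map f v' = v"
      by (metis map_eq_append_conv)
    then have "b' = b" using inj[of b' b] sub by auto
    with w b(3) m show ?thesis by blast
  qed
  from 1 2 b(1) show ?thesis
    unfolding closed_string_def by blast
qed

lemma closed_string_map:
  assumes "inj_on f (set w)"
  shows "closed_string (map f w) \<longleftrightarrow> closed_string w"
proof
  assume "closed_string (map f w)"
  moreover have "inj_on (the_inv_into (set w) f) (set (map f w))"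
    using assms by (simp add: inj_on_the_inv_into)
  ultimately have "closed_string (map (the_inv_into (set w) f) (map f w))"
    by (rule closed_string_map_imp[rotated])
  moreover have "map (the_inv_into (set w) f) (map f w) = w"
    using assms by (auto simp: the_inv_into_f_f intro: map_idI)
  ultimately show "closed_string w" by simp
qed (rule closed_string_map_imp[OF assms])

lemma OC_map: "OC (map f S) = OC S" if "inj_on f (set S)"
  using closed_string_map[of f "take i S" for i] that
  by (auto simp: OC_def fun_eq_iff take_map inj_on_subset[OF _ set_take_subset])

lemma OC_nat_alphabet: "\<exists>T :: nat list. length T = length S \<and> OC T = OC S"
  by (metis OC_map finite_imp_inj_to_nat_seg finite_set length_map)

end

theory Submission
  imports Defs
begin

text \<open>A closed prefix of length \<open>e\<close> has a shift \<open>p\<close>: its border of length \<open>f = e - p\<close> occurs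
  in it only at the offsets \<open>0\<close> and \<open>p\<close>. Consider the lengths \<open>e\<close> at which the OC
  array drops from 1 to 0; there the period \<open>p\<close> breaks. Along the successive drops both \<open>p\<close> and \<open>f\<close>
  increase strictly. For three drops with shifts \<open>p\<^sub>1 < p\<^sub>2 < p\<^sub>3\<close>, overlapping occurrences give the
  prefix of length \<open>f\<^sub>1\<close> the period \<open>p\<^sub>2 - p\<^sub>1\<close>, which breaks right after it, while the prefix of
  length \<open>f\<^sub>2 > f\<^sub>1\<close> has the period \<open>p\<^sub>3 - p\<^sub>2\<close>. These two periods would be compatible if their sum
  were at most \<open>f\<^sub>1\<close>; hence \<open>p\<^sub>3 - p\<^sub>1 > f\<^sub>1\<close>. As \<open>f\<close> at the \<open>i\<close>-th drop is at least \<open>i\<close>, the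
  shifts grow quadratically in the number of drops.\<close>

text \<open>The border is encoded by its offset \<open>p\<close>, so its length is
  \<open>e - p\<close>. Allowing \<open>p = e\<close> covers the convention for length 1: the empty
  border matches at every offset, so uniqueness then forces \<open>e = 1\<close>.\<close>

definition closed_shift :: "'a list \<Rightarrow> nat \<Rightarrow> nat \<Rightarrow> bool" where
  "closed_shift S e p \<longleftrightarrow> 0 < p \<and> p \<le> e \<and> (\<forall>i<e - p. S ! (p + i) = S ! i) \<and>
     (\<forall>q. q + (e - p) \<le> e \<and> (\<forall>i<e - p. S ! (q + i) = S ! i) \<longrightarrow> q = 0 \<or> q = p)"

text \<open>List indices start at 0, so \<open>S ! e\<close> is the letter that follows the prefix
  of length \<open>e\<close>.\<close>

definition drop_shift :: "'a list \<Rightarrow> nat \<Rightarrow> nat \<Rightarrow> bool" where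
  "drop_shift S e p \<longleftrightarrow> closed_shift S e p \<and> S ! e \<noteq> S ! (e - p)"

section \<open>Closed prefixes in terms of shifts\<close>

lemma closed_shift_if_closed:
  assumes "closed_string (take e S)" "e \<le> length S"
  shows "\<exists>p. closed_shift S e p"
proof (cases "e = 1")
  case True
  then have "closed_shift S e 1"
    by (auto simp: closed_shift_def)
  then show ?thesis ..
next
  case False
  with assms obtain b where b: "b \<noteq> []" "border b (take e S)"
    and uniq: "\<And>u v. take e S = u @ b @ v \<Longrightarrow> u = [] \<or> v = []"
    by (auto simp: closed_string_def)
  obtain v where v: "take e S = b @ v"
    using b by (auto simp: border_def prefix_def)
  obtain u where u: "take e S = u @ b"
    using b by (auto simp: border_def suffix_def)
  define p where "p = length u"
  have lu: "p + length b = e"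
    using arg_cong[OF u, of length] assms(2) by (simp add: p_def)
  have "p > 0"
    using b u by (auto simp: border_def p_def)
  have bi: "b ! i = S ! i" if "i < length b" for i
    using that lu arg_cong[OF v, of "\<lambda>x. x ! i"] by (simp add: nth_append)
  have bp: "b ! i = S ! (p + i)" if "i < length b" for i
    using that lu arg_cong[OF u, of "\<lambda>x. x ! (p + i)"] by (simp add: nth_append p_def)
  have "q = 0 \<or> q = p"
    if q: "q + length b \<le> e" "\<forall>i<length b. S ! (q + i) = S ! i" for q
  proof -
    let ?w = "take e S"
    have "take (length b) (drop q ?w) = b"
      using q assms(2) bi by (intro nth_equalityI) auto
    then have "?w = take q ?w @ b @ drop (length b) (drop q ?w)"
      by (metis append_take_drop_id)
    from uniq[OF this] show ?thesis
      using q lu assms(2) by auto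
  qed
  moreover have "e - p = length b"
    using lu by simp
  ultimately have "closed_shift S e p"
    using \<open>p > 0\<close> bi bp lu by (auto simp: closed_shift_def)
  then show ?thesis ..
qed

lemma closed_if_closed_shift:
  assumes "closed_shift S e p" "e \<le> length S"
  shows "closed_string (take e S)"
proof (cases "p < e")
  case False
  then have "p = e" "e > 0"
    using assms by (auto simp: closed_shift_def)
  moreover from this have "\<And>q. q \<le> e \<Longrightarrow> q = 0 \<or> q = e"
    using assms(1) unfolding closed_shift_def by simp
  from this[of 1] have "e = 1"
    using \<open>e > 0\<close> by simp
  then show ?thesis
    using assms(2) by (simp add: closed_string_def)
next
  case True
  let ?w = "take e S"
  define b where "b = take (e - p) ?w"
  have p: "0 < p" and per: "\<And>i. i < e - p \<Longrightarrow> S ! (p + i) = S ! i"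
    using assms(1) by (auto simp: closed_shift_def)
  have lb: "length b = e - p"
    using assms(2) by (simp add: b_def)
  have bi: "b ! i = S ! i" if "i < e - p" for i
    using that assms(2) by (simp add: b_def)
  have "b = drop p ?w"
    using True assms(2) per bi lb by (intro nth_equalityI) auto
  then have "border b ?w"
    using p lb True assms(2) unfolding border_def
    by (metis b_def diff_less length_take less_irrefl min_absorb2 order.strict_trans
        suffix_drop take_is_prefix)
  moreover have "u = [] \<or> v = []" if w: "?w = u @ b @ v" for u v
  proof -
    have len: "length u + (e - p) + length v = e"
      using arg_cong[OF w, of length] assms(2) lb by simp
    have "S ! (length u + i) = S ! i" if "i < e - p" for i
      using that arg_cong[OF w, of "\<lambda>x. x ! (length u + i)"] len lb bi
      by (simp add: nth_append)
    moreover have "length u + (e - p) \<le> e"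
      using len by linarith
    ultimately have "length u = 0 \<or> length u = p"
      using assms(1) unfolding closed_shift_def by blast
    then show ?thesis
      using len True by auto
  qed
  moreover have "b \<noteq> []"
    using lb True by auto
  ultimately show ?thesis
    unfolding closed_string_def by blast
qed

text \<open>An occurrence of the lengthened border in the longer prefix restricts to one of the old
  border in the old prefix at the same offset, so no new offset can appear.\<close>

lemma closed_shift_Suc:
  assumes "closed_shift S e p" "S ! e = S ! (e - p)"
  shows "closed_shift S (Suc e) p"
  using assms unfolding closed_shift_def
  by (auto simp: Suc_diff_le less_Suc_eq)

lemma drop_shift_exists:
  assumes "closed_string (take e S)" "\<not> closed_string (take (Suc e) S)" "e < length S"
  shows "\<exists>p. drop_shift S e p"
  using assms closed_shift_if_closed[of e S] closed_if_closed_shift[of S "Suc e"]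
    closed_shift_Suc[of S e]
  by (auto simp: drop_shift_def)

section \<open>Monotonicity and gaps of the shifts\<close>

lemma drop_shift_less:
  assumes "drop_shift S e p" "drop_shift S e' p'" "e < e'"
  shows "p < p'" "e - p < e' - p'"
proof -
  note d = assms[unfolded drop_shift_def closed_shift_def]
  have per: "S ! (p + i) = S ! i" if "i < e - p" for i
    using d that by blast
  have per': "S ! (p' + i) = S ! i" if "i < e' - p'" for i
    using d that by blast
  have uniq: "q = 0 \<or> q = p" if "q + (e - p) \<le> e" "\<forall>i<e - p. S ! (q + i) = S ! i" for q
    using d that by blast
  have uniq': "q = 0 \<or> q = p'" if "q + (e' - p') \<le> e'" "\<forall>i<e' - p'. S ! (q + i) = S ! i" for q
    using d that by blast
  have p: "0 < p" "p \<le> e" "0 < p'" "p' \<le> e'"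
    using d by auto
  \<comment> \<open>With a common shift, the longer prefix would keep the period \<open>p\<close>
    across index \<open>e\<close>, where it breaks.\<close>
  have "p \<noteq> p'"
  proof
    assume "p = p'"
    moreover have "S ! (p + (e - p)) \<noteq> S ! (e - p)"
      using d by simp
    moreover have "e - p' < e' - p'"
      using assms(3) p \<open>p = p'\<close> by linarith
    ultimately show False
      using per'[of "e - p"] by simp
  qed
  \<comment> \<open>Otherwise the second border, being no longer than the first, would have a third
    occurrence at offset \<open>p\<close>.\<close>
  show f: "e - p < e' - p'"
  proof (rule ccontr)
    assume *: "\<not> e - p < e' - p'"
    then have "p + (e' - p') \<le> e'"
      using p assms(3) by linarith
    then show False
      using uniq'[of p] per * p \<open>p \<noteq> p'\<close> by auto
  qed
  \<comment> \<open>Otherwise the first border, a prefix of the second, would have a third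
    occurrence at offset \<open>p'\<close>.\<close>
  show "p < p'"
  proof (rule ccontr)
    assume *: "\<not> p < p'"
    then have "p' + (e - p) \<le> e"
      using p by linarith
    then show False
      using uniq[of p'] per' f p \<open>p \<noteq> p'\<close> by auto
  qed
qed

lemma drop_shift_gap:
  assumes "drop_shift S e\<^sub>1 p\<^sub>1" "drop_shift S e\<^sub>2 p\<^sub>2" "drop_shift S e\<^sub>3 p\<^sub>3" "e\<^sub>1 < e\<^sub>2" "e\<^sub>2 < e\<^sub>3"
  shows "p\<^sub>1 + (e\<^sub>1 - p\<^sub>1) < p\<^sub>3"
proof (rule ccontr)
  assume neg: "\<not> ?thesis"
  define f\<^sub>1 f\<^sub>2 f\<^sub>3 where "f\<^sub>1 = e\<^sub>1 - p\<^sub>1" and "f\<^sub>2 = e\<^sub>2 - p\<^sub>2" and "f\<^sub>3 = e\<^sub>3 - p\<^sub>3"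
  note f_defs = f\<^sub>1_def f\<^sub>2_def f\<^sub>3_def
  have p: "p\<^sub>1 < p\<^sub>2" "p\<^sub>2 < p\<^sub>3" and f: "f\<^sub>1 < f\<^sub>2" "f\<^sub>2 < f\<^sub>3"
    using drop_shift_less assms unfolding f_defs by blast+
  have e\<^sub>1: "e\<^sub>1 = p\<^sub>1 + f\<^sub>1"
    using assms(1) by (simp add: f_defs drop_shift_def closed_shift_def)
  have per1: "S ! (p\<^sub>1 + i) = S ! i" if "i < f\<^sub>1" for i
    using assms(1) that by (simp add: f_defs drop_shift_def closed_shift_def)
  have per2: "S ! (p\<^sub>2 + i) = S ! i" if "i < f\<^sub>2" for i
    using assms(2) that by (simp add: f_defs drop_shift_def closed_shift_def)
  have per3: "S ! (p\<^sub>3 + i) = S ! i" if "i < f\<^sub>3" for i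
    using assms(3) that by (simp add: f_defs drop_shift_def closed_shift_def)
  have brk: "S ! (p\<^sub>1 + f\<^sub>1) \<noteq> S ! f\<^sub>1"
    using assms(1) unfolding drop_shift_def e\<^sub>1 by simp
  define a where "a = p\<^sub>2 - p\<^sub>1"
  define b where "b = p\<^sub>3 - p\<^sub>2"
  have p\<^sub>2: "p\<^sub>2 = p\<^sub>1 + a" and p\<^sub>3: "p\<^sub>3 = p\<^sub>2 + b"
    using p by (auto simp: a_def b_def)
  have "a + b \<le> f\<^sub>1"
    using neg p\<^sub>2 p\<^sub>3 by (simp add: f_defs)
  then obtain c where c: "f\<^sub>1 = c + a + b"
    by (metis add.assoc add.commute le_Suc_ex)
  have "b > 0"
    using p by (simp add: b_def)
  have pera: "S ! (a + i) = S ! i" if "a + i < f\<^sub>1" for i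
    using per1[of "a + i"] per2[of i] that f by (simp add: p\<^sub>2 add.assoc)
  have perb: "S ! (b + i) = S ! i" if "b + i < f\<^sub>2" for i
    using per2[of "b + i"] per3[of i] that f by (simp add: p\<^sub>3 add.assoc)
  have "S ! f\<^sub>1 = S ! (a + c)"
    using perb[of "a + c"] f c by (simp add: ac_simps)
  also have "\<dots> = S ! c"
    using pera[of c] c \<open>b > 0\<close> by simp
  also have "\<dots> = S ! (b + c)"
    using perb[of c] c f by simp
  also have "\<dots> = S ! (p\<^sub>2 + (b + c))"
    using per2[of "b + c"] c f by simp
  also have "p\<^sub>2 + (b + c) = p\<^sub>1 + f\<^sub>1"
    using c by (simp add: p\<^sub>2)
  finally show False
    using brk by simp
qed

section \<open>Quadratic growth and the number of drops\<close>

lemma quadratic_growth: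
  fixes p f :: "nat \<Rightarrow> nat"
  assumes f: "\<And>i j. i < j \<Longrightarrow> j < m \<Longrightarrow> f i < f j"
    and gap: "\<And>i. i + 2 < m \<Longrightarrow> p i + f i < p (i + 2)"
  shows "2 * j < m \<Longrightarrow> j * j \<le> p (2 * j)"
proof (induction j)
  case (Suc j)
  have ge: "i < m \<Longrightarrow> i \<le> f i" for i
  proof (induction i)
    case (Suc i)
    then show ?case
      using f[of i "Suc i"] by simp
  qed simp
  \<comment> \<open>Two further drops add more than \<open>f (2 * j) \<ge> 2 * j\<close> to the
    shift, and \<open>2 * j + 1\<close> is the difference of the squares of \<open>j + 1\<close> and
    \<open>j\<close>.\<close>
  show ?case
    using Suc ge[of "2 * j"] gap[of "2 * j"] by simp
qed simp

text \<open>Subtracting 1 makes \<open>2 * j\<close> a valid index, counted from 0, into the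
  increasing list of \<open>D\<close>. The shift there is at least \<open>j * j\<close> and at most
  the length of its prefix, which is below \<open>n\<close>.\<close>

lemma card_drops:
  assumes "finite D" "D \<noteq> {}" and D: "\<And>e. e \<in> D \<Longrightarrow> e < n \<and> drop_shift S e (p e)"
  defines "j \<equiv> (card D - 1) div 2"
  shows "j * j < n"
proof -
  define l where "l = sorted_list_of_set D"
  define m where "m = card D"
  have len: "length l = m" and set: "set l = D"
    using assms(1) by (auto simp: l_def m_def)
  have less: "l ! i < l ! k" if "i < k" "k < m" for i k
    using that len sorted_wrt_nth_less[OF strict_sorted_list_of_set[of D]]
    by (simp add: l_def)
  have in_D: "l ! i \<in> D" if "i < m" for i
    using that len set nth_mem by blast
  have "m > 0"
    using assms(1,2) by (simp add: m_def card_gt_0_iff)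
  then have j: "2 * j < m"
    by (simp add: j_def m_def)
  have "j * j \<le> p (l ! (2 * j))"
  proof (rule quadratic_growth[where p = "\<lambda>i. p (l ! i)" and f = "\<lambda>i. l ! i - p (l ! i)", OF _ _ j])
    show "l ! i - p (l ! i) < l ! k - p (l ! k)" if "i < k" "k < m" for i k
      using drop_shift_less(2)[of S "l ! i" _ "l ! k"] that less in_D D by simp
    show "p (l ! i) + (l ! i - p (l ! i)) < p (l ! (i + 2))" if "i + 2 < m" for i
    proof (rule drop_shift_gap)
      show "drop_shift S (l ! i) (p (l ! i))" "drop_shift S (l ! (i + 1)) (p (l ! (i + 1)))"
        "drop_shift S (l ! (i + 2)) (p (l ! (i + 2)))"
        using that in_D D by simp_all
      show "l ! i < l ! (i + 1)" "l ! (i + 1) < l ! (i + 2)"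
        using that less by simp_all
    qed
  qed
  also have "\<dots> \<le> l ! (2 * j)"
    using D[OF in_D[OF j]] by (simp add: drop_shift_def closed_shift_def)
  also have "\<dots> < n"
    using D[OF in_D[OF j]] by simp
  finally show ?thesis .
qed

section \<open>From runs to drops\<close>

lemma card_runs_le_changes:
  "card (runs A n) \<le> card {j \<in> {1..<n}. A j \<noteq> A (Suc j)} + 1"
proof -
  let ?C = "{j \<in> {1..<n}. A j \<noteq> A (Suc j)}"
  have Max_ivl: "Max {i..j} = j" if "i \<le> j" for i j :: nat
    using that by (intro Max_eqI) auto
  \<comment> \<open>Runs with the same right end are nested, hence equal by maximality, so it
    suffices to count right ends.\<close>
  have "inj_on Max (runs A n)"
  proof (rule inj_onI)
    fix B B' assume B: "B \<in> runs A n" "B' \<in> runs A n" "Max B = Max B'"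
    obtain i j where "i \<le> j" "B = {i..j}"
      using B(1) unfolding runs_def constant_block_def by blast
    moreover obtain i' j' where "i' \<le> j'" "B' = {i'..j'}"
      using B(2) unfolding runs_def constant_block_def by blast
    moreover from calculation B(3) have "j = j'"
      by (simp add: Max_ivl)
    ultimately have "B \<subseteq> B' \<or> B' \<subseteq> B"
      by auto
    then show "B = B'"
      using B(1,2) unfolding runs_def by blast
  qed
  moreover have "Max ` runs A n \<subseteq> insert n ?C"
  proof (rule image_subsetI)
    fix B assume B: "B \<in> runs A n"
    then obtain i j where ij: "1 \<le> i" "i \<le> j" "j \<le> n" "B = {i..j}"
      and const: "\<forall>k\<in>B. \<forall>l\<in>B. A k = A l"
      unfolding runs_def constant_block_def by blast
    \<comment> \<open>Without a change of value the run could be extended by one position.\<close>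
    have "A j \<noteq> A (Suc j)" if "j < n"
    proof
      assume eq: "A j = A (Suc j)"
      have ins: "{i..Suc j} = insert (Suc j) B"
        using ij by auto
      have "j \<in> B"
        using ij by simp
      then have "A k = A j" if "k \<in> {i..Suc j}" for k
        using that const eq[symmetric] unfolding ins by blast
      then have "\<forall>k\<in>{i..Suc j}. \<forall>l\<in>{i..Suc j}. A k = A l"
        by (metis (no_types, lifting))
      moreover have "\<exists>i' j'. 1 \<le> i' \<and> i' \<le> j' \<and> j' \<le> n \<and> {i..Suc j} = {i'..j'}"
        using ij \<open>j < n\<close> by (intro exI[of _ i] exI[of _ "Suc j"]) simp
      ultimately have "constant_block A n {i..Suc j}"
        unfolding constant_block_def by blast
      then have "{i..Suc j} = B"
        using B ins unfolding runs_def by blast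
      then show False
        using ij by auto
    qed
    then show "Max B \<in> insert n ?C"
      using ij by (cases "j = n") (auto simp: Max_ivl)
  qed
  ultimately have "card (runs A n) \<le> card (insert n ?C)"
    by (rule card_inj_on_le) simp
  also have "\<dots> \<le> card ?C + 1"
    by (simp add: card_insert_if)
  finally show ?thesis .
qed

text \<open>Drops and rises alternate. The term \<open>A n\<close> pays for a last rise that no drop
  follows; in the induction it grows at a rise, and the factor 2 makes up for its loss at a
  drop.\<close>

lemma card_changes_le_drops:
  fixes A :: "nat \<Rightarrow> nat"
  assumes "\<And>i. A i \<in> {0, 1}" "n \<ge> 1"
  shows "card {j \<in> {1..<n}. A j \<noteq> A (Suc j)}
    \<le> 2 * card {j \<in> {1..<n}. A j = 1 \<and> A (Suc j) = 0} + A n"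
  using assms(2)
proof (induction n rule: dec_induct)
  case (step n)
  have split: "card {j \<in> {1..<Suc n}. P j} = card {j \<in> {1..<n}. P j} + (if P n then 1 else 0)" for P
  proof -
    have "{j \<in> {1..<Suc n}. P j} = {j \<in> {1..<n}. P j} \<union> (if P n then {n} else {})"
      using step(1) by (auto simp: less_Suc_eq)
    then show ?thesis
      by auto
  qed
  show ?case
    using step.IH assms(1)[of n] assms(1)[of "Suc n"] unfolding split by auto
qed simp

lemma card_runs_OC:
  assumes "length S \<ge> 1"
  shows "real (card (runs (OC S) (length S))) \<le> 10 * sqrt (real (length S))"
proof -
  let ?n = "length S"
  define D where "D = {j \<in> {1..<?n}. OC S j = 1 \<and> OC S (Suc j) = 0}"
  define j where "j = (card D - 1) div 2"
  have "OC S i \<in> {0, 1}" for i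
    by (simp add: OC_def)
  moreover from this have "OC S ?n \<le> 1"
    by (auto simp: OC_def)
  ultimately have runs: "card (runs (OC S) ?n) \<le> 2 * card D + 2"
    using card_runs_le_changes[of "OC S" ?n] card_changes_le_drops[of "OC S" ?n] assms
    by (simp add: D_def)
  have "\<exists>p. drop_shift S e p" if "e \<in> D" for e
    using that drop_shift_exists[of e S] by (auto simp: D_def OC_def split: if_splits)
  then obtain p where p: "\<And>e. e \<in> D \<Longrightarrow> drop_shift S e (p e)"
    by metis
  have "j * j \<le> ?n"
  proof (cases "D = {}")
    case False
    moreover have "finite D" "\<And>e. e \<in> D \<Longrightarrow> e < ?n"
      by (auto simp: D_def)
    ultimately show ?thesis
      using card_drops[of D ?n S p] p unfolding j_def by (simp add: less_imp_le)
  qed (simp add: j_def)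
  then have "real j * real j \<le> real ?n"
    by (metis of_nat_le_iff of_nat_mult)
  then have "real j \<le> sqrt (real ?n)"
    by (simp add: real_le_rsqrt power2_eq_square)
  moreover have "card D \<le> 2 * j + 2"
    by (simp add: j_def)
  \<comment> \<open>The constant 10 comes from \<open>2 * card D + 2 \<le> 4 * j + 6\<close>, where
    both \<open>j\<close> and 1 are at most the square root of the length.\<close>
  ultimately show ?thesis
    using runs assms real_sqrt_ge_one[of "real ?n"] by linarith
qed

theorem theorem1:
  "\<exists>C::real. C > 0 \<and>
     (\<forall>S :: 'a list. length S \<ge> 1 \<longrightarrow>
        real (card (runs (OC S) (length S))) \<le> C * sqrt (real (length S)))"
  using card_runs_OC by (intro exI[of _ 10]) auto

end
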